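(* Let $A=(A_1\;\;A_2)\in\mathbb{R}^{m\times n}$ with $A_1\in\mathbb{R}^{m\times k}$ and $A_2\in\mathbb{R}^{m\times(n-k)}$, and let $\tau>0$. Let $s=\operatorname{rank}(P_{A_1}^{\perp}(A_2))$ and let $\sigma_1,\dots,\sigma_s$ be the nonzero singular values of $P_{A_1}^{\perp}(A_2)$; assume that $\sigma_1>\sigma_2>\cdots>\sigma_s>0$. Denote $\sigma_0:=\infty$ and $\sigma_{s+1}:=0$. For a weight matrix $W=(W_1\;\;W_2)$ with $W_1\in\mathbb{R}^{m\times k}$, $W_2\in\mathbb{R}^{m\times(n-k)}$, let $(\hat X_1(W)\;\;\hat X_2(W))$ be a solution of $$\min_{X_1\in\mathbb{R}^{m\times k},\,X_2\in\mathbb{R}^{m\times(n-k)}}\Big\{\big\|\big((A_1\;\;A_2)-(X_1\;\;X_2)\big)\odot(W_1\;\;W_2)\big\|_F^2+\tau\operatorname{rank}(X_1\;\;X_2)\Big\}.$$ Then the accumulation point of $(\hat X_1(W)\;\;\hat X_2(W))$ as $(W_1)_{ij}\to\infty$ and $(W_2)_{ij}\to1$ is unique, and this unique accumulation point is given by $$\Big(A_1\;\;\;\;P_{A_1}(A_2)+H_{r^*}\big(P_{A_1}^{\perp}(A_2)\big)\Big)$$ with $r^*$ satisfying $$\sigma_{r^*+1}^2\le\tau<\sigma_{r^*}^2 .$$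
   Context: $\|\cdot\|_F$ is the Frobenius norm and $\odot$ is the Hadamard (entrywise) product. $P_{A_1}$ and $P_{A_1}^{\perp}$ denote the orthogonal projections onto the column space of $A_1$ and onto its orthogonal complement, applied to matrices columnwise. For a matrix $M$ with singular value decomposition $M=U\Sigma V^T$ (singular values in non-increasing order), $H_q(M):=U\Sigma_qV^T$, where $\Sigma_q$ is obtained from $\Sigma$ by keeping the $q$ largest singular values and replacing the others by $0$. The limit is taken with all entries of $W_1$ tending to $\infty$ and all entries of $W_2$ tending to $1$; an accumulation point is a limit of $(\hat X_1(W)\;\;\hat X_2(W))$ along some sequence of weights $W$ with this property. Here $r^*\in\{0,1,\dots,s\}$.
   Formalization: It is additionally assumed that τ ≠ σ_i² for i = 1,…,s; without this the claim fails: for A_1 = e_1, A_2 = e_2, τ = σ_1² = 1, letting W_2 tend to 1 from above or below gives two accumulation points, (e_1 e_2) and (e_1 0). *)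

theory Defs
  imports "HOL-Analysis.Analysis"
begin

text \<open>
  A real matrix with rows indexed by \<^typ>\<open>'m\<close> and columns indexed by \<^typ>\<open>'n\<close>
  has type \<^typ>\<open>real^'n^'m\<close>.  Block matrices \<open>(B C)\<close> have columns indexed by the sum type.
\<close>

definition block :: "real^'k^'m \<Rightarrow> real^'l^'m \<Rightarrow> real^('k + 'l)^'m" where
  "block B C = (\<chi> i j. case j of Inl a \<Rightarrow> B $ i $ a | Inr b \<Rightarrow> C $ i $ b)"

definition frob_norm :: "real^'n^'m \<Rightarrow> real" where
  "frob_norm M = sqrt (\<Sum>i\<in>UNIV. \<Sum>j\<in>UNIV. (M $ i $ j)\<^sup>2)"

definition hadamard :: "real^'n^'m \<Rightarrow> real^'n^'m \<Rightarrow> real^'n^'m" where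
  "hadamard M N = (\<chi> i j. M $ i $ j * N $ i $ j)"

text \<open>The description below is only meaningful for a subspace \<open>S\<close>.\<close>

definition orth_proj :: "(real^'m) set \<Rightarrow> real^'m \<Rightarrow> real^'m" where
  "orth_proj S x = (THE y. y \<in> S \<and> (\<forall>z\<in>S. orthogonal (x - y) z))"

definition map_columns :: "(real^'m \<Rightarrow> real^'m) \<Rightarrow> real^'n^'m \<Rightarrow> real^'n^'m" where
  "map_columns f M = (\<chi> i j. f (column j M) $ i)"

definition P_col :: "real^'k^'m \<Rightarrow> real^'n^'m \<Rightarrow> real^'n^'m" where
  "P_col A = map_columns (orth_proj (span (columns A)))"

definition P_perp :: "real^'k^'m \<Rightarrow> real^'n^'m \<Rightarrow> real^'n^'m" where
  "P_perp A = map_columns (orth_proj (orthogonal_comp (span (columns A))))"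

text \<open>
  Index types carry no order, so the main diagonal of a rectangular matrix is located by
  enumerating rows and columns as \<open>1, 2, \<dots>\<close>.  Which enumeration is used does not matter for the
  singular value decomposition: another one permutes the columns of the two orthogonal factors.
\<close>

definition pos :: "'a::finite \<Rightarrow> nat" where
  "pos i = Suc (to_nat_on (UNIV :: 'a set) i)"

definition rect_diag :: "(nat \<Rightarrow> real) \<Rightarrow> real^'n^'m" where
  "rect_diag d = (\<chi> i j. if pos i = pos j then d (pos i) else 0)"

text \<open>
  \<open>M = U \<Sigma> V\<^sup>T\<close>, where \<open>\<Sigma>\<close> has the diagonal \<open>\<sigma> 1 \<ge> \<sigma> 2 \<ge> \<dots> \<ge> \<sigma> p \<ge> 0\<close> with \<open>p\<close> the smaller
  of the two dimensions; other values of \<open>\<sigma>\<close> are irrelevant.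
\<close>

definition is_svd :: "real^'n^'m \<Rightarrow> real^'m^'m \<Rightarrow> (nat \<Rightarrow> real) \<Rightarrow> real^'n^'n \<Rightarrow> bool" where
  "is_svd M U \<sigma> V \<longleftrightarrow>
     orthogonal_matrix U \<and> orthogonal_matrix V \<and>
     (\<forall>i\<in>{1..min CARD('m) CARD('n)}. 0 \<le> \<sigma> i) \<and>
     (\<forall>i j. 1 \<le> i \<and> i \<le> j \<and> j \<le> min CARD('m) CARD('n) \<longrightarrow> \<sigma> j \<le> \<sigma> i) \<and>
     M = U ** rect_diag \<sigma> ** transpose V"

text \<open>\<open>H\<^sub>q(M) = U \<Sigma>\<^sub>q V\<^sup>T\<close>, expressed through a singular value decomposition of \<open>M\<close>.\<close>

definition hard_threshold ::
    "nat \<Rightarrow> real^'m^'m \<Rightarrow> (nat \<Rightarrow> real) \<Rightarrow> real^'n^'n \<Rightarrow> real^'n^'m" where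
  "hard_threshold q U \<sigma> V = U ** rect_diag (\<lambda>i. if i \<le> q then \<sigma> i else 0) ** transpose V"

text \<open>The conventions \<open>\<sigma>\<^sub>0 = \<infinity>\<close> and \<open>\<sigma>\<^bsub>s+1\<^esub> = 0\<close>.\<close>

definition sv_ext :: "nat \<Rightarrow> (nat \<Rightarrow> real) \<Rightarrow> nat \<Rightarrow> ereal" where
  "sv_ext s \<sigma> i = (if i = 0 then \<infinity> else if i \<le> s then ereal (\<sigma> i) else 0)"

definition cost :: "real^'n^'m \<Rightarrow> real \<Rightarrow> real^'n^'m \<Rightarrow> real^'n^'m \<Rightarrow> real" where
  "cost A \<tau> W X = (frob_norm (hadamard (A - X) W))\<^sup>2 + \<tau> * real (rank X)"

definition is_solution :: "real^'n^'m \<Rightarrow> real \<Rightarrow> real^'n^'m \<Rightarrow> real^'n^'m \<Rightarrow> bool" where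
  "is_solution A \<tau> W X \<longleftrightarrow> is_arg_min (cost A \<tau> W) (\<lambda>_. True) X"

definition accumulation_point ::
    "(real^('k::finite + 'l::finite)^'m::finite \<Rightarrow> real^('k + 'l)^'m) \<Rightarrow> real^('k + 'l)^'m \<Rightarrow> bool" where
  "accumulation_point Xhat L \<longleftrightarrow>
     (\<exists>(W1 :: nat \<Rightarrow> real^'k^'m) (W2 :: nat \<Rightarrow> real^'l^'m).
        (\<forall>i j. filterlim (\<lambda>t. W1 t $ i $ j) at_top sequentially) \<and>
        (\<forall>i j. (\<lambda>t. W2 t $ i $ j) \<longlonglongrightarrow> 1) \<and>
        (\<lambda>t. Xhat (block (W1 t) (W2 t))) \<longlonglongrightarrow> L)"

end

theory Submission
  imports Defs
begin

text \<open>
  Optimality keeps the weighted residual of \<open>A1\<close> bounded, so every accumulation point has the form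
  \<open>(A1 L2)\<close>; since the rank can only drop in a limit, \<open>L2\<close> minimises
  \<open>\<parallel>A2 - Y\<parallel>\<^sup>2 + \<tau> * rank (A1 Y)\<close> over \<open>Y\<close>.  To bound this from below, let \<open>S\<close> be the column space of
  \<open>(A1 Y)\<close> and let \<open>p i\<close> be the squared norm of the projection to \<open>S\<close> of the \<open>i\<close>-th left singular
  vector of \<open>P_perp A1 A2\<close>.  The \<open>p i\<close> sum to \<open>dim S\<close>, so the objective is at least the sum of
  \<open>(\<sigma> i)\<^sup>2 * (1 - p i) + \<tau> * p i\<close>.  If \<open>\<sigma> i > 0\<close>, the summand has a unique minimiser
  because \<open>\<tau> \<noteq> (\<sigma> i)\<^sup>2\<close>; if \<open>\<sigma> i = 0\<close>, it is minimal for the smallest \<open>p i\<close> allowed by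
  \<open>columns A1 \<subseteq> S\<close>.  All minima are attained together, by a single \<open>Y\<close>.
\<close>

subsection \<open>Orthogonal projections\<close>

text \<open>The difference of two candidates lies in \<open>S\<close> and is orthogonal to itself,
  hence zero. All later evaluations of the definite description go through this rule.\<close>

lemma orth_proj_eqI:
  assumes S: "subspace S" and y: "y \<in> S" and o: "\<And>z. z \<in> S \<Longrightarrow> orthogonal (x - y) z"
  shows "orth_proj S x = y"
  unfolding orth_proj_def
proof (rule the_equality)
  fix y' assume y': "y' \<in> S \<and> (\<forall>z\<in>S. orthogonal (x - y') z)"
  then have "y' - y \<in> S"
    using S y by (simp add: subspace_diff)
  then have "(x - y) \<bullet> (y' - y) = 0" "(x - y') \<bullet> (y' - y) = 0"
    using o y' by (auto simp: orthogonal_def)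
  then have "(y' - y) \<bullet> (y' - y) = 0"
    by (simp add: inner_diff_left)
  then show "y' = y" by simp
qed (use y o in auto)

lemma orth_proj_in_and_orthogonal:
  assumes "subspace S"
  shows orth_proj_in: "orth_proj S x \<in> S"
    and orthogonal_orth_proj: "z \<in> S \<Longrightarrow> orthogonal (x - orth_proj S x) z"
proof -
  obtain y w where "y \<in> span S" and w: "\<And>z. z \<in> span S \<Longrightarrow> orthogonal w z" and x: "x = y + w"
    using orthogonal_subspace_decomp_exists by blast
  moreover have "span S = S"
    using assms by (simp add: span_eq_iff)
  ultimately have y: "y \<in> S" "\<And>z. z \<in> S \<Longrightarrow> orthogonal (x - y) z"
    by auto
  then have "orth_proj S x = y"
    by (intro orth_proj_eqI assms)
  with y show "orth_proj S x \<in> S" "z \<in> S \<Longrightarrow> orthogonal (x - orth_proj S x) z"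
    by auto
qed

lemma linear_orth_proj:
  fixes S :: "(real^'m) set"
  assumes "subspace S"
  shows "linear (orth_proj S)"
proof (rule linearI)
  fix x y :: "real^'m" and c :: real
  have "orthogonal (x - orth_proj S x) z" "orthogonal (y - orth_proj S y) z" if "z \<in> S" for z
    using orthogonal_orth_proj[OF assms that] by auto
  moreover have "orth_proj S x \<in> S" "orth_proj S y \<in> S"
    using orth_proj_in[OF assms] by auto
  ultimately show "orth_proj S (x + y) = orth_proj S x + orth_proj S y"
      "orth_proj S (c *\<^sub>R x) = c *\<^sub>R orth_proj S x"
    using assms
    by (auto intro!: orth_proj_eqI
        simp: subspace_add subspace_scale orthogonal_def inner_diff_left inner_add_left)
qed

lemma orth_proj_ident: "subspace S \<Longrightarrow> x \<in> S \<Longrightarrow> orth_proj S x = x"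
  by (rule orth_proj_eqI) (auto simp: orthogonal_def)

lemma orth_proj_zero:
  assumes "subspace S" "\<And>z. z \<in> S \<Longrightarrow> orthogonal x z"
  shows "orth_proj S x = 0"
  using assms by (intro orth_proj_eqI) (auto simp: subspace_0)

lemma orth_proj_orthogonal_comp:
  assumes S: "subspace S"
  shows "orth_proj (orthogonal_comp S) x = x - orth_proj S x"
proof (rule orth_proj_eqI)
  show "x - orth_proj S x \<in> orthogonal_comp S"
    using orthogonal_orth_proj[OF S] by (auto simp: orthogonal_comp_def orthogonal_commute)
  show "orthogonal (x - (x - orth_proj S x)) z" if "z \<in> orthogonal_comp S" for z
    using that orth_proj_in[OF S] by (auto simp: orthogonal_comp_def)
qed (rule subspace_orthogonal_comp)

text \<open>Pythagoras for the residual and a vector of \<open>S\<close>. The first summand does not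
  depend on \<open>y\<close>, so the projection is the nearest point of \<open>S\<close>.\<close>

lemma norm_sq_diff_eq_orth_proj:
  assumes S: "subspace S" and y: "y \<in> S"
  shows "(norm (x - y))\<^sup>2 = (norm (x - orth_proj S x))\<^sup>2 + (norm (orth_proj S x - y))\<^sup>2"
proof -
  have "orthogonal (x - orth_proj S x) (orth_proj S x - y)"
    using S y by (simp add: orth_proj_in orthogonal_orth_proj subspace_diff)
  from norm_add_Pythagorean[OF this] show ?thesis
    by simp
qed

lemma norm_sq_minus_orth_proj:
  assumes S: "subspace S"
  shows "(norm (x - orth_proj S x))\<^sup>2 = (norm x)\<^sup>2 - (norm (orth_proj S x))\<^sup>2"
  using norm_sq_diff_eq_orth_proj[OF S subspace_0[OF S], of x] by simp

text \<open>The larger space contains a point at least as near to \<open>x\<close>, and by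
  Pythagoras a shorter residual means a longer projection.\<close>

lemma norm_orth_proj_mono:
  assumes K: "subspace K" and S: "subspace S" and "K \<subseteq> S"
  shows "norm (orth_proj K x) \<le> norm (orth_proj S x)"
proof -
  have "orth_proj K x \<in> S"
    using orth_proj_in[OF K] assms(3) by auto
  then have "(norm (x - orth_proj S x))\<^sup>2 \<le> (norm (x - orth_proj K x))\<^sup>2"
    using norm_sq_diff_eq_orth_proj[OF S, of "orth_proj K x" x] by simp
  then have "(norm (orth_proj K x))\<^sup>2 \<le> (norm (orth_proj S x))\<^sup>2"
    by (simp add: norm_sq_minus_orth_proj[OF S] norm_sq_minus_orth_proj[OF K])
  then show ?thesis
    by (rule power2_le_imp_le[OF _ norm_ge_zero])
qed

lemma norm_orth_proj_le: "subspace S \<Longrightarrow> norm (orth_proj S x) \<le> norm x"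
  using norm_orth_proj_mono[of S UNIV x] by (simp add: orth_proj_ident)

text \<open>The dimension is the trace of the orthogonal projection.\<close>

lemma dim_eq_sum_norm_orth_proj:
  fixes u :: "'i::finite \<Rightarrow> real^'m"
  assumes S: "subspace S" and parseval: "\<And>x. (\<Sum>i\<in>UNIV. (u i \<bullet> x)\<^sup>2) = (norm x)\<^sup>2"
  shows "real (dim S) = (\<Sum>i\<in>UNIV. (norm (orth_proj S (u i)))\<^sup>2)"
proof -
  obtain B where BS: "B \<subseteq> S" and orth: "pairwise orthogonal B"
    and B1: "\<And>x. x \<in> B \<Longrightarrow> norm x = 1"
    and "independent B" and card: "card B = dim S" and span: "span B = S"
    using orthonormal_basis_subspace[OF S] by metis
  then have fin: "finite B"
    by (simp add: independent_imp_finite)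
  have BB: "b \<bullet> b' = (if b = b' then 1 else 0)" if "b \<in> B" "b' \<in> B" for b b'
    using that B1 orth by (auto simp: pairwise_def orthogonal_def norm_eq_1)
  have proj: "orth_proj S x = (\<Sum>b\<in>B. (x \<bullet> b) *\<^sub>R b)" for x
  proof (rule orth_proj_eqI[OF S])
    show "(\<Sum>b\<in>B. (x \<bullet> b) *\<^sub>R b) \<in> S"
      using BS S by (intro subspace_sum subspace_scale) auto
    fix z assume "z \<in> S"
    then have z: "z \<in> span B" by (simp add: span)
    have "orthogonal (x - (\<Sum>b\<in>B. (x \<bullet> b) *\<^sub>R b)) b'" if "b' \<in> B" for b'
      using that fin
      by (simp add: orthogonal_def inner_diff_left inner_sum_left BB if_distrib[of "\<lambda>t. _ * t"] cong: if_cong)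
    then show "orthogonal (x - (\<Sum>b\<in>B. (x \<bullet> b) *\<^sub>R b)) z"
      using orthogonal_to_span z by blast
  qed
  have nrm: "(norm (orth_proj S x))\<^sup>2 = (\<Sum>b\<in>B. (x \<bullet> b)\<^sup>2)" for x
  proof -
    have "(norm (orth_proj S x))\<^sup>2 = (\<Sum>b\<in>B. \<Sum>b'\<in>B. (x \<bullet> b) * ((x \<bullet> b') * (b \<bullet> b')))"
      unfolding proj power2_norm_eq_inner by (simp add: inner_sum_left inner_sum_right sum_distrib_left mult.left_commute inner_commute)
    also have "\<dots> = (\<Sum>b\<in>B. (x \<bullet> b)\<^sup>2)"
      by (rule sum.cong) (simp_all add: BB fin if_distrib[of "\<lambda>t. _ * t"] power2_eq_square cong: if_cong)
    finally show ?thesis .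
  qed
  \<comment> \<open>Double counting of \<open>(u i \<bullet> b)\<^sup>2\<close>: summed over
    \<open>b\<close> these squares give the projection norms, summed over \<open>i\<close> they give
    \<open>(norm b)\<^sup>2 = 1\<close>.\<close>
  have "(\<Sum>i\<in>UNIV. (norm (orth_proj S (u i)))\<^sup>2) = (\<Sum>b\<in>B. \<Sum>i\<in>UNIV. (u i \<bullet> b)\<^sup>2)"
    unfolding nrm by (rule sum.swap)
  also have "\<dots> = real (card B)"
    unfolding parseval using B1 by simp
  finally show ?thesis
    by (simp add: card)
qed

text \<open>
  Replacing each \<open>y j\<close> by the projection of \<open>a j\<close> to \<open>S\<close> only lowers the cost, which then becomes
  the sum over \<open>i\<close> of \<open>(d i)\<^sup>2 * (1 - p i) + \<tau> * p i\<close>, where \<open>p i \<in> {0..1}\<close> is the squared norm of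
  the projection of \<open>u i\<close> to \<open>S\<close>.
\<close>

lemma penalised_minimiser_unique:
  fixes u :: "'i::finite \<Rightarrow> real^'m" and c :: "'i \<Rightarrow> 'l::finite \<Rightarrow> real" and a y :: "'l \<Rightarrow> real^'m"
  assumes K: "subspace K" and S: "subspace S" and KS: "K \<subseteq> S"
    and parseval: "\<And>x. (\<Sum>i\<in>UNIV. (u i \<bullet> x)\<^sup>2) = (norm x)\<^sup>2"
    and u1: "\<And>i. norm (u i) = 1"
    and gram: "\<And>i i'. (\<Sum>j\<in>UNIV. c i j * c i' j) = (if i = i' then (d i)\<^sup>2 else 0)"
    and uK: "\<And>i z. d i \<noteq> 0 \<Longrightarrow> z \<in> K \<Longrightarrow> orthogonal (u i) z"
    and aK: "\<And>j. a j - (\<Sum>i\<in>UNIV. c i j *\<^sub>R u i) \<in> K"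
    and yS: "\<And>j. y j \<in> S"
    and \<tau>: "\<tau> > 0" and generic: "\<And>i. (d i)\<^sup>2 \<noteq> \<tau>"
    and opt: "(\<Sum>j\<in>UNIV. (norm (a j - y j))\<^sup>2) + \<tau> * dim S \<le> (\<Sum>i\<in>UNIV. min ((d i)\<^sup>2) \<tau>) + \<tau> * dim K"
  shows "y j = a j - (\<Sum>i\<in>UNIV. if (d i)\<^sup>2 < \<tau> then c i j *\<^sub>R u i else 0)"
proof -
  define P where "P = orth_proj S"
  define p where "p i = (norm (P (u i)))\<^sup>2" for i
  define k where "k i = (norm (orth_proj K (u i)))\<^sup>2" for i
  define Q where "Q x = x - P x" for x
  have lP: "linear P"
    unfolding P_def by (rule linear_orth_proj[OF S])
  then have lQ: "linear Q"
    unfolding Q_def by (intro linear_compose_sub linear_ident)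
  have Q_u: "(norm (Q (u i)))\<^sup>2 = 1 - p i" for i
    using u1 by (simp add: Q_def p_def P_def norm_sq_minus_orth_proj[OF S])
  have p1: "p i \<le> 1" for i
    using norm_orth_proj_le[OF S, of "u i"] by (simp add: p_def P_def u1 power_le_one)
  have kp: "k i \<le> p i" for i
    unfolding k_def p_def P_def by (intro power_mono norm_orth_proj_mono K S KS) simp
  have k0: "k i = 0" if "d i \<noteq> 0" for i
    using orth_proj_zero[OF K] uK[OF that] by (simp add: k_def)
  have p0: "p i \<ge> 0" for i by (simp add: p_def)
  \<comment> \<open>The component of \<open>a j\<close> in \<open>K\<close> already lies in
    \<open>S\<close> and is fixed by \<open>P\<close>, so the whole residual comes from the vectors
    \<open>u i\<close>.\<close>
  have Pa: "P (a j) = a j - (\<Sum>i\<in>UNIV. c i j *\<^sub>R Q (u i))" for j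
  proof -
    have "P (a j - (\<Sum>i\<in>UNIV. c i j *\<^sub>R u i)) = a j - (\<Sum>i\<in>UNIV. c i j *\<^sub>R u i)"
      unfolding P_def using aK KS by (intro orth_proj_ident S) auto
    then have "Q (a j - (\<Sum>i\<in>UNIV. c i j *\<^sub>R u i)) = 0"
      by (simp add: Q_def)
    then have "Q (a j) = (\<Sum>i\<in>UNIV. c i j *\<^sub>R Q (u i))"
      by (simp add: linear_diff[OF lQ] linear_sum[OF lQ] linear_cmul[OF lQ])
    then show ?thesis by (simp add: Q_def algebra_simps)
  qed
  \<comment> \<open>The vectors \<open>Q (u i)\<close> may fail to be orthogonal to each other. The
    mixed terms still cancel, because summing over \<open>j\<close> first produces the diagonal
    matrix of \<open>gram\<close>.\<close>
  have "(\<Sum>j\<in>UNIV. (norm (a j - P (a j)))\<^sup>2)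
      = (\<Sum>j\<in>UNIV. \<Sum>i\<in>UNIV. \<Sum>i'\<in>UNIV. c i j * c i' j * (Q (u i) \<bullet> Q (u i')))"
    unfolding Pa power2_norm_eq_inner
    by (simp add: inner_sum_left inner_sum_right sum_distrib_left mult_ac inner_commute)
  also have "\<dots> = (\<Sum>i\<in>UNIV. \<Sum>i'\<in>UNIV. \<Sum>j\<in>UNIV. c i j * c i' j * (Q (u i) \<bullet> Q (u i')))"
    by (subst sum.swap) (intro sum.cong refl sum.swap)
  also have "\<dots> = (\<Sum>i\<in>UNIV. \<Sum>i'\<in>UNIV. (if i = i' then (d i)\<^sup>2 else 0) * (Q (u i) \<bullet> Q (u i')))"
    by (simp add: sum_distrib_right[symmetric] gram)
  also have "\<dots> = (\<Sum>i\<in>UNIV. (d i)\<^sup>2 * (1 - p i))"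
    by (simp add: if_distrib[of "\<lambda>t. t * _"] Q_u[symmetric] power2_norm_eq_inner cong: if_cong)
  finally have res: "(\<Sum>j\<in>UNIV. (norm (a j - P (a j)))\<^sup>2) = (\<Sum>i\<in>UNIV. (d i)\<^sup>2 * (1 - p i))" .
  \<comment> \<open>The excess of the \<open>i\<close>-th summand over its least value. The term
    \<open>\<tau> * k i\<close> is the share of index \<open>i\<close> in
    \<open>\<tau> * dim K\<close>; it is nonzero only where \<open>d i = 0\<close>.\<close>
  define g where "g i = (d i)\<^sup>2 * (1 - p i) + \<tau> * p i - min ((d i)\<^sup>2) \<tau> - \<tau> * k i" for i
  have g_lt: "g i = (\<tau> - (d i)\<^sup>2) * p i" if "(d i)\<^sup>2 < \<tau>" "d i \<noteq> 0" for i
    using that by (simp add: g_def k0 algebra_simps)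
  have g_gt: "g i = ((d i)\<^sup>2 - \<tau>) * (1 - p i)" if "(d i)\<^sup>2 > \<tau>" for i
    using that \<tau> k0[of i] by (cases "d i = 0") (auto simp: g_def algebra_simps)
  have g0: "g i \<ge> 0" for i
  proof (cases "d i = 0")
    case True
    then have "g i = \<tau> * (p i - k i)"
      using \<tau> by (simp add: g_def algebra_simps)
    then show ?thesis using \<tau> kp by simp
  next
    case False
    then show ?thesis
      using g_lt[of i] g_gt[of i] p0[of i] p1[of i] generic[of i] by (cases "(d i)\<^sup>2 < \<tau>") auto
  qed
  have split: "(norm (a j - y j))\<^sup>2 = (norm (a j - P (a j)))\<^sup>2 + (norm (P (a j) - y j))\<^sup>2" for j
    unfolding P_def by (rule norm_sq_diff_eq_orth_proj[OF S yS])
  have dim: "real (dim S) = (\<Sum>i\<in>UNIV. p i)"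
    unfolding p_def P_def by (rule dim_eq_sum_norm_orth_proj[OF S parseval])
  have "(\<Sum>j\<in>UNIV. (norm (a j - y j))\<^sup>2) + \<tau> * dim S
      = (\<Sum>i\<in>UNIV. (d i)\<^sup>2 * (1 - p i)) + (\<Sum>j\<in>UNIV. (norm (P (a j) - y j))\<^sup>2) + \<tau> * (\<Sum>i\<in>UNIV. p i)"
    unfolding split by (simp add: sum.distrib res dim)
  moreover have "real (dim K) = (\<Sum>i\<in>UNIV. k i)"
    by (simp add: k_def dim_eq_sum_norm_orth_proj[OF K parseval])
  ultimately have "(\<Sum>i\<in>UNIV. g i) + (\<Sum>j\<in>UNIV. (norm (P (a j) - y j))\<^sup>2) \<le> 0"
    using opt by (simp add: g_def sum.distrib sum_subtractf sum_distrib_left)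
  moreover have "(\<Sum>i\<in>UNIV. g i) \<ge> 0" "(\<Sum>j\<in>UNIV. (norm (P (a j) - y j))\<^sup>2) \<ge> 0"
    by (auto intro!: sum_nonneg g0)
  ultimately have "(\<Sum>i\<in>UNIV. g i) = 0" and "(\<Sum>j\<in>UNIV. (norm (P (a j) - y j))\<^sup>2) = 0"
    by linarith+
  then have gz: "\<And>i. g i = 0" and yP: "y j = P (a j)"
    using g0 by (auto simp: sum_nonneg_eq_0_iff)
  \<comment> \<open>Zero excess forces \<open>p i = 0\<close> below the threshold, so
    \<open>u i\<close> is orthogonal to \<open>S\<close>, and \<open>p i = 1\<close> above it, so
    \<open>u i\<close> lies in \<open>S\<close>. Where \<open>d i = 0\<close> the value of
    \<open>p i\<close> stays open, but row \<open>i\<close> of \<open>c\<close> vanishes by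
    \<open>gram\<close>.\<close>
  have "c i j *\<^sub>R Q (u i) = (if (d i)\<^sup>2 < \<tau> then c i j *\<^sub>R u i else 0)" for i
  proof (cases "d i = 0")
    case True
    then have "(\<Sum>j\<in>UNIV. (c i j)\<^sup>2) = 0"
      using gram[of i i] by (simp add: power2_eq_square)
    then have "c i j = 0"
      by (auto simp: sum_nonneg_eq_0_iff)
    then show ?thesis by simp
  next
    case False
    show ?thesis
    proof (cases "(d i)\<^sup>2 < \<tau>")
      case True
      then have "p i = 0" using gz[of i] g_lt[OF True False] by simp
      then show ?thesis using True by (simp add: p_def Q_def)
    next
      case False
      then have "(d i)\<^sup>2 > \<tau>" using generic[of i] by simp
      then have "1 - p i = 0" using gz[of i] g_gt[of i] by simp
      then show ?thesis using Q_u[of i] False by simp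
    qed
  qed
  then show ?thesis
    using yP Pa[of j] by simp
qed

subsection \<open>Passing to the limit of the weights\<close>

lemma frob_norm_eq_norm: "frob_norm M = norm M"
  by (simp add: frob_norm_def norm_vec_def L2_set_def sum_nonneg)

lemma norm_sq_eq_sum_columns:
  fixes M :: "real^'n^'m"
  shows "(norm M)\<^sup>2 = (\<Sum>j\<in>UNIV. (norm (column j M))\<^sup>2)"
proof -
  have "(norm M)\<^sup>2 = (\<Sum>i\<in>UNIV. \<Sum>j\<in>UNIV. (M $ i $ j)\<^sup>2)"
    unfolding frob_norm_eq_norm[symmetric] frob_norm_def by (simp add: sum_nonneg)
  also have "\<dots> = (\<Sum>j\<in>UNIV. \<Sum>i\<in>UNIV. (M $ i $ j)\<^sup>2)"
    by (rule sum.swap)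
  also have "\<dots> = (\<Sum>j\<in>UNIV. (norm (column j M))\<^sup>2)"
    by (simp add: norm_vec_def L2_set_def sum_nonneg column_def)
  finally show ?thesis .
qed

lemma column_diff: "column j (M - N) = column j M - column j N"
  by (simp add: vec_eq_iff column_def)

lemma sum_UNIV_Plus:
  "(\<Sum>x\<in>(UNIV :: ('a::finite + 'b::finite) set). f x) = (\<Sum>a\<in>UNIV. f (Inl a)) + (\<Sum>b\<in>UNIV. f (Inr b))"
  by (simp add: UNIV_Plus_UNIV[symmetric] sum.Plus comp_def del: UNIV_Plus_UNIV)

lemma column_block [simp]:
  "column (Inl a) (block B C) = column a B" "column (Inr b) (block B C) = column b C"
  by (simp_all add: vec_eq_iff column_def block_def)

lemma columns_block: "columns (block B C) = columns B \<union> columns C"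
proof -
  have "columns (block B C) = range (\<lambda>j. column j (block B C))"
    by (auto simp: columns_def)
  also have "\<dots> = columns B \<union> columns C"
    unfolding UNIV_Plus_UNIV[symmetric] Plus_def image_Un image_image column_block
    by (auto simp: columns_def)
  finally show ?thesis .
qed

lemma block_nth [simp]:
  "block B C $ i $ Inl a = B $ i $ a" "block B C $ i $ Inr b = C $ i $ b"
  by (simp_all add: block_def)

lemma exhaust_block:
  obtains B C where "X = block B C"
proof
  show "X = block (\<chi> i a. X $ i $ Inl a) (\<chi> i b. X $ i $ Inr b)"
    by (auto simp: vec_eq_iff block_def split: sum.split)
qed

text \<open>
  A matrix is injective, hence bounded below, on its row space, and this persists under small
  perturbations.
\<close>

lemma eventually_rank_ge:
  fixes X :: "nat \<Rightarrow> real^'n^'m"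
  assumes "X \<longlonglongrightarrow> L"
  shows "\<forall>\<^sub>F t in sequentially. rank L \<le> rank (X t)"
proof -
  let ?R = "span (rows L)"
  have inj: "x = 0" if x: "x \<in> ?R" "L *v x = 0" for x
  proof -
    have "orthogonal x r" if "r \<in> rows L" for r
    proof -
      from that obtain i where "r = L $ i" by (auto simp: rows_def row_def)
      moreover have "(L *v x) $ i = 0" by (simp add: x(2))
      ultimately show ?thesis
        by (simp add: matrix_vector_mul_component orthogonal_def inner_commute)
    qed
    then have "orthogonal x x"
      using orthogonal_to_span x(1) by blast
    then show ?thesis by (simp add: orthogonal_self)
  qed
  have "\<exists>e>0. \<forall>x\<in>?R. norm (L *v x) \<ge> e * norm x"
    by (rule injective_imp_isometric) (auto simp: matrix_vector_mul_bounded_linear closed_span inj)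
  then obtain e where e: "e > 0" "\<And>x. x \<in> ?R \<Longrightarrow> norm (L *v x) \<ge> e * norm x"
    by auto
  have "((\<lambda>t. onorm ((*v) (X t - L))) \<longlongrightarrow> 0) sequentially"
  proof (rule tendsto_sandwich[of "\<lambda>_. 0" _ _ "\<lambda>t. \<Sum>i\<in>UNIV. \<Sum>j\<in>UNIV. \<bar>(X t - L) $ i $ j\<bar>"])
    show "\<forall>\<^sub>F t in sequentially. onorm ((*v) (X t - L)) \<le> (\<Sum>i\<in>UNIV. \<Sum>j\<in>UNIV. \<bar>(X t - L) $ i $ j\<bar>)"
      by (intro always_eventually allI onorm_le_matrix_component_sum)
    have "(\<lambda>t. \<Sum>i\<in>UNIV. \<Sum>j\<in>UNIV. \<bar>(X t - L) $ i $ j\<bar>) \<longlonglongrightarrow> (\<Sum>i\<in>UNIV. \<Sum>j\<in>UNIV. \<bar>(L - L) $ i $ j\<bar>)"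
      using assms by (intro tendsto_intros)
    then show "(\<lambda>t. \<Sum>i\<in>UNIV. \<Sum>j\<in>UNIV. \<bar>(X t - L) $ i $ j\<bar>) \<longlonglongrightarrow> 0"
      by simp
  qed (auto simp: onorm_pos_le matrix_vector_mul_bounded_linear)
  then have "\<forall>\<^sub>F t in sequentially. onorm ((*v) (X t - L)) < e"
    using e(1) by (rule order_tendstoD)
  then show ?thesis
  proof eventually_elim
    case (elim t)
    have "x = 0" if x: "x \<in> ?R" "X t *v x = 0" for x
    proof (rule ccontr)
      assume "x \<noteq> 0"
      have "e * norm x \<le> norm (L *v x)"
        using e x by simp
      also have "\<dots> = norm ((X t - L) *v x)"
        using x(2) by (simp add: matrix_vector_mult_diff_rdistrib)
      also have "\<dots> \<le> onorm ((*v) (X t - L)) * norm x"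
        by (intro onorm matrix_vector_mul_bounded_linear)
      also have "\<dots> < e * norm x"
        using elim \<open>x \<noteq> 0\<close> by simp
      finally show False by simp
    qed
    then have "inj_on ((*v) (X t)) (span ?R)"
      unfolding span_span
      by (intro inj_onI) (metis eq_iff_diff_eq_0 matrix_vector_mult_diff_distrib span_diff)
    then have "dim ((*v) (X t) ` ?R) = dim ?R"
      by (intro dim_image_eq matrix_vector_mul_linear)
    moreover have "dim ((*v) (X t) ` ?R) \<le> rank (X t)"
      unfolding rank_dim_range by (intro dim_subset) auto
    ultimately show ?case
      by (simp add: row_rank_def)
  qed
qed

section \<open>Optimality along sequences of weights\<close>

lemma cost_block:
  "cost (block A1 A2) \<tau> (block W1 W2) (block X1 X2) =
    (\<Sum>i\<in>UNIV. \<Sum>a\<in>UNIV. ((A1 $ i $ a - X1 $ i $ a) * W1 $ i $ a)\<^sup>2) +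
    (\<Sum>i\<in>UNIV. \<Sum>b\<in>UNIV. ((A2 $ i $ b - X2 $ i $ b) * W2 $ i $ b)\<^sup>2) + \<tau> * real (rank (block X1 X2))"
proof -
  have "0 \<le> (\<Sum>i\<in>UNIV. \<Sum>j\<in>UNIV. (hadamard (block A1 A2 - block X1 X2) (block W1 W2) $ i $ j)\<^sup>2)"
    by (intro sum_nonneg) auto
  then show ?thesis
    by (simp add: cost_def frob_norm_def hadamard_def sum_UNIV_Plus sum.distrib)
qed

lemma is_solution_le: "is_solution A \<tau> W X \<Longrightarrow> cost A \<tau> W X \<le> cost A \<tau> W Y"
  by (auto simp: is_solution_def is_arg_min_linorder)

text \<open>Eventually \<open>\<bar>x t\<bar> \<le> sqrt c / w t\<close>. This is what pins the
  first block of an accumulation point to \<open>A1\<close>.\<close>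

lemma tendsto_zero_if_scaled_bounded:
  fixes x w :: "nat \<Rightarrow> real"
  assumes w: "filterlim w at_top sequentially" and b: "\<forall>\<^sub>F t in sequentially. (x t * w t)\<^sup>2 \<le> c"
  shows "x \<longlonglongrightarrow> 0"
proof (rule Lim_null_comparison)
  have "\<forall>\<^sub>F t in sequentially. w t > 0"
    using w by (simp add: filterlim_at_top_dense)
  with b show "\<forall>\<^sub>F t in sequentially. norm (x t) \<le> sqrt c / w t"
  proof eventually_elim
    case (elim t)
    then have "\<bar>x t * w t\<bar> \<le> sqrt c"
      using real_le_rsqrt[of "\<bar>x t * w t\<bar>"] by simp
    then show ?case
      using elim by (simp add: abs_mult field_simps)
  qed
  show "(\<lambda>t. sqrt c / w t) \<longlonglongrightarrow> 0"
    by (rule tendsto_divide_0[OF tendsto_const]) (rule filterlim_at_top_imp_at_infinity[OF w])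
qed

text \<open>A competitor \<open>block A1 Y\<close> has no residual in the first block, so its cost
  converges although the weights there diverge. The solutions cost at most as much, and their cost
  only decreases when the residual of the first block is dropped.\<close>

lemma accumulation_point_minimises:
  fixes A1 :: "real^'k^'m" and A2 :: "real^'l^'m"
  assumes \<tau>: "\<tau> > 0"
    and solution: "\<And>W. (\<And>i j. W $ i $ j > 0) \<Longrightarrow> is_solution (block A1 A2) \<tau> W (Xhat W)"
    and acc: "accumulation_point Xhat L"
  obtains L2 where "L = block A1 L2"
    "\<And>Y. (norm (A2 - L2))\<^sup>2 + \<tau> * rank (block A1 L2) \<le> (norm (A2 - Y))\<^sup>2 + \<tau> * rank (block A1 Y)"
proof -
  obtain W1 :: "nat \<Rightarrow> real^'k^'m" and W2 :: "nat \<Rightarrow> real^'l^'m"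
    where W1: "\<And>i j. filterlim (\<lambda>t. W1 t $ i $ j) at_top sequentially"
      and W2: "\<And>i j. (\<lambda>t. W2 t $ i $ j) \<longlonglongrightarrow> 1"
      and lim: "(\<lambda>t. Xhat (block (W1 t) (W2 t))) \<longlonglongrightarrow> L"
    using acc unfolding accumulation_point_def by blast
  define X where "X t = Xhat (block (W1 t) (W2 t))" for t
  define X1 where "X1 t = (\<chi> i a. X t $ i $ Inl a)" for t
  define X2 where "X2 t = (\<chi> i b. X t $ i $ Inr b)" for t
  have X: "X t = block (X1 t) (X2 t)" for t
    by (auto simp: X1_def X2_def vec_eq_iff block_def split: sum.split)
  obtain L1 L2 where L: "L = block L1 L2"
    by (rule exhaust_block)
  have lim_nth: "(\<lambda>t. X t $ i $ j) \<longlonglongrightarrow> L $ i $ j" for i j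
    using lim unfolding X_def by (intro tendsto_vec_nth)
  have lim1: "(\<lambda>t. X1 t $ i $ a) \<longlonglongrightarrow> L1 $ i $ a" for i a
    using lim_nth[of i "Inl a"] by (simp add: X L)
  have lim2: "(\<lambda>t. X2 t $ i $ b) \<longlonglongrightarrow> L2 $ i $ b" for i b
    using lim_nth[of i "Inr b"] by (simp add: X L)
  have "\<forall>\<^sub>F t in sequentially. \<forall>i j. W1 t $ i $ j > 0"
    using W1 by (intro eventually_all_finite) (simp add: filterlim_at_top_dense)
  moreover have "\<forall>\<^sub>F t in sequentially. \<forall>i j. W2 t $ i $ j > 0"
    using W2 by (intro eventually_all_finite) (rule order_tendstoD, auto)
  ultimately have "\<forall>\<^sub>F t in sequentially. \<forall>Y. cost (block A1 A2) \<tau> (block (W1 t) (W2 t)) (X t)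
      \<le> cost (block A1 A2) \<tau> (block (W1 t) (W2 t)) Y"
  proof eventually_elim
    case (elim t)
    have "is_solution (block A1 A2) \<tau> (block (W1 t) (W2 t)) (X t)"
      unfolding X_def
    proof (rule solution)
      show "block (W1 t) (W2 t) $ i $ j > 0" for i j
        using elim by (cases j) auto
    qed
    then show ?case by (blast intro: is_solution_le)
  qed
  then have opt: "\<forall>\<^sub>F t in sequentially.
      (\<Sum>i\<in>UNIV. \<Sum>a\<in>UNIV. ((A1 $ i $ a - X1 t $ i $ a) * W1 t $ i $ a)\<^sup>2) +
      (\<Sum>i\<in>UNIV. \<Sum>b\<in>UNIV. ((A2 $ i $ b - X2 t $ i $ b) * W2 t $ i $ b)\<^sup>2) + \<tau> * rank (X t)
      \<le> (\<Sum>i\<in>UNIV. \<Sum>b\<in>UNIV. ((A2 $ i $ b - Y $ i $ b) * W2 t $ i $ b)\<^sup>2) + \<tau> * rank (block A1 Y)" for Y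
  proof eventually_elim
    case (elim t)
    from elim[rule_format, of "block A1 Y"] show ?case
      unfolding X cost_block by simp
  qed
  have "L1 $ i $ a = A1 $ i $ a" for i a
  proof -
    \<comment> \<open>The competitor \<open>block A1 A2\<close> has no residual at all, so its cost
      is the rank penalty alone, a bound independent of \<open>t\<close>.\<close>
    from opt[of A2] have "\<forall>\<^sub>F t in sequentially. ((A1 $ i $ a - X1 t $ i $ a) * W1 t $ i $ a)\<^sup>2 \<le> \<tau> * rank (block A1 A2)"
    proof eventually_elim
      case (elim t)
      have "((A1 $ i $ a - X1 t $ i $ a) * W1 t $ i $ a)\<^sup>2 \<le> (\<Sum>a\<in>UNIV. ((A1 $ i $ a - X1 t $ i $ a) * W1 t $ i $ a)\<^sup>2)"
        by (rule member_le_sum) auto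
      also have "\<dots> \<le> (\<Sum>i\<in>UNIV. \<Sum>a\<in>UNIV. ((A1 $ i $ a - X1 t $ i $ a) * W1 t $ i $ a)\<^sup>2)"
        by (rule member_le_sum[of _ _ "\<lambda>i. \<Sum>a\<in>UNIV. ((A1 $ i $ a - X1 t $ i $ a) * W1 t $ i $ a)\<^sup>2"]) (auto intro: sum_nonneg)
      finally have 1: "((A1 $ i $ a - X1 t $ i $ a) * W1 t $ i $ a)\<^sup>2 \<le> (\<Sum>i\<in>UNIV. \<Sum>a\<in>UNIV. ((A1 $ i $ a - X1 t $ i $ a) * W1 t $ i $ a)\<^sup>2)" .
      have 2: "0 \<le> (\<Sum>i\<in>UNIV. \<Sum>b\<in>UNIV. ((A2 $ i $ b - X2 t $ i $ b) * W2 t $ i $ b)\<^sup>2)" "0 \<le> \<tau> * rank (X t)"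
        using \<tau> by (auto intro!: sum_nonneg)
      show ?case using elim 1 2 by simp
    qed
    then have "(\<lambda>t. A1 $ i $ a - X1 t $ i $ a) \<longlonglongrightarrow> 0"
      by (rule tendsto_zero_if_scaled_bounded[OF W1])
    moreover have "(\<lambda>t. A1 $ i $ a - X1 t $ i $ a) \<longlonglongrightarrow> A1 $ i $ a - L1 $ i $ a"
      by (intro tendsto_intros lim1)
    ultimately show ?thesis
      using LIMSEQ_unique by fastforce
  qed
  then have L1: "L1 = A1" by (simp add: vec_eq_iff)
  show thesis
  proof (rule that)
    show "L = block A1 L2" using L L1 by simp
    fix Y :: "real^'l^'m"
    have sq: "(norm (A2 - Z))\<^sup>2 = (\<Sum>i\<in>UNIV. \<Sum>b\<in>UNIV. ((A2 $ i $ b - Z $ i $ b) * 1)\<^sup>2)" for Z :: "real^'l^'m"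
      unfolding frob_norm_eq_norm[symmetric] frob_norm_def by (simp add: sum_nonneg)
    show "(norm (A2 - L2))\<^sup>2 + \<tau> * rank (block A1 L2) \<le> (norm (A2 - Y))\<^sup>2 + \<tau> * rank (block A1 Y)"
      unfolding sq
    proof (rule tendsto_le[OF sequentially_bot])
      show "(\<lambda>t. (\<Sum>i\<in>UNIV. \<Sum>b\<in>UNIV. ((A2 $ i $ b - Y $ i $ b) * W2 t $ i $ b)\<^sup>2) + \<tau> * rank (block A1 Y))
          \<longlonglongrightarrow> (\<Sum>i\<in>UNIV. \<Sum>b\<in>UNIV. ((A2 $ i $ b - Y $ i $ b) * 1)\<^sup>2) + \<tau> * rank (block A1 Y)"
        by (intro tendsto_intros W2)
      show "(\<lambda>t. (\<Sum>i\<in>UNIV. \<Sum>b\<in>UNIV. ((A2 $ i $ b - X2 t $ i $ b) * W2 t $ i $ b)\<^sup>2) + \<tau> * rank (block A1 L2))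
          \<longlonglongrightarrow> (\<Sum>i\<in>UNIV. \<Sum>b\<in>UNIV. ((A2 $ i $ b - L2 $ i $ b) * 1)\<^sup>2) + \<tau> * rank (block A1 L2)"
        by (intro tendsto_intros W2 lim2)
      \<comment> \<open>The rank of \<open>X t\<close> may stay above that of the limit, so it is
        replaced by the eventual lower bound \<open>rank (block A1 L2)\<close> before passing to the
        limit.\<close>
      from opt[of Y] eventually_rank_ge[OF lim[folded X_def]]
      show "\<forall>\<^sub>F t in sequentially.
        (\<Sum>i\<in>UNIV. \<Sum>b\<in>UNIV. ((A2 $ i $ b - X2 t $ i $ b) * W2 t $ i $ b)\<^sup>2) + \<tau> * rank (block A1 L2)
        \<le> (\<Sum>i\<in>UNIV. \<Sum>b\<in>UNIV. ((A2 $ i $ b - Y $ i $ b) * W2 t $ i $ b)\<^sup>2) + \<tau> * rank (block A1 Y)"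
      proof eventually_elim
        case (elim t)
        have "0 \<le> (\<Sum>i\<in>UNIV. \<Sum>a\<in>UNIV. ((A1 $ i $ a - X1 t $ i $ a) * W1 t $ i $ a)\<^sup>2)"
          by (auto intro!: sum_nonneg)
        moreover have "\<tau> * rank (block A1 L2) \<le> \<tau> * rank (X t)"
          using elim(2) \<tau> L L1 by simp
        ultimately show ?case using elim(1) by linarith
      qed
    qed
  qed
qed

text \<open>Weights of at least 1 make the cost dominate the plain squared distance to the data.
  Comparison with the data matrix itself then confines the solutions to a ball, which is
  compact.\<close>

lemma accumulation_point_exists:
  fixes A1 :: "real^'k^'m" and A2 :: "real^'l^'m"
  assumes \<tau>: "\<tau> > 0"
    and solution: "\<And>W. (\<And>i j. W $ i $ j > 0) \<Longrightarrow> is_solution (block A1 A2) \<tau> W (Xhat W)"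
  shows "\<exists>L. accumulation_point Xhat L"
proof -
  let ?A = "block A1 A2"
  \<comment> \<open>Starting at \<open>Suc 0\<close> keeps every weight at least 1, so the bound
    below holds for all \<open>t\<close>.\<close>
  define W1 :: "nat \<Rightarrow> real^'k^'m" where "W1 t = (\<chi> i j. real (Suc t))" for t
  define W2 :: "nat \<Rightarrow> real^'l^'m" where "W2 t = (\<chi> i j. 1)" for t
  define W where "W t = block (W1 t) (W2 t)" for t
  have W1': "W t $ i $ j \<ge> 1" for t i j
    by (cases j) (auto simp: W_def W1_def W2_def)
  have "norm (Xhat (W t) - ?A) \<le> sqrt (\<tau> * rank ?A)" for t
  proof (rule real_le_rsqrt)
    have "(norm (Xhat (W t) - ?A))\<^sup>2 = (\<Sum>i\<in>UNIV. \<Sum>j\<in>UNIV. ((?A - Xhat (W t)) $ i $ j)\<^sup>2)"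
      unfolding frob_norm_eq_norm[symmetric] frob_norm_def by (simp add: sum_nonneg power2_commute)
    also have "\<dots> \<le> (\<Sum>i\<in>UNIV. \<Sum>j\<in>UNIV. ((?A - Xhat (W t)) $ i $ j * W t $ i $ j)\<^sup>2)"
    proof (intro sum_mono)
      fix i j
      have "(W t $ i $ j)\<^sup>2 \<ge> 1" using W1' by (simp add: one_le_power)
      then show "((?A - Xhat (W t)) $ i $ j)\<^sup>2 \<le> ((?A - Xhat (W t)) $ i $ j * W t $ i $ j)\<^sup>2"
        by (simp add: power_mult_distrib mult_le_cancel_left1)
    qed
    also have "\<dots> \<le> cost ?A \<tau> (W t) (Xhat (W t))"
      using \<tau> by (simp add: cost_def frob_norm_def hadamard_def sum_nonneg)
    also have "\<dots> \<le> cost ?A \<tau> (W t) ?A"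
      by (intro is_solution_le solution less_le_trans[OF zero_less_one W1'])
    also have "\<dots> = \<tau> * rank ?A"
      by (simp add: cost_def frob_norm_def hadamard_def)
    finally show "(norm (Xhat (W t) - ?A))\<^sup>2 \<le> \<tau> * rank ?A" .
  qed
  then have "\<forall>t. Xhat (W t) \<in> cball ?A (sqrt (\<tau> * rank ?A))"
    by (simp add: dist_norm norm_minus_commute)
  then obtain L f where f: "strict_mono f" and L: "((\<lambda>t. Xhat (W t)) \<circ> f) \<longlonglongrightarrow> L"
    using compact_cball[of ?A "sqrt (\<tau> * rank ?A)"] unfolding compact_def by metis
  \<comment> \<open>The weights of the convergent subsequence are themselves an admissible
    sequence.\<close>
  have "filterlim (\<lambda>t. W1 (f t) $ i $ j) at_top sequentially" for i j
    using filterlim_compose[OF filterlim_real_sequentially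
        filterlim_compose[OF filterlim_Suc filterlim_subseq[OF f]]]
    by (simp add: W1_def)
  moreover have "(\<lambda>t. W2 (f t) $ i $ j) \<longlonglongrightarrow> 1" for i j
    by (simp add: W2_def)
  ultimately have "accumulation_point Xhat L"
    unfolding accumulation_point_def using L
    by (intro exI[of _ "\<lambda>t. W1 (f t)"] exI[of _ "\<lambda>t. W2 (f t)"]) (simp add: W_def comp_def)
  then show ?thesis ..
qed

subsection \<open>Singular value decompositions\<close>

lemma pos_image: "pos ` (UNIV :: 'a::finite set) = {1..CARD('a)}"
proof -
  have "pos ` (UNIV :: 'a set) = Suc ` (to_nat_on (UNIV :: 'a set) ` UNIV)"
    by (auto simp: pos_def)
  also have "to_nat_on (UNIV :: 'a set) ` UNIV = {..<CARD('a)}"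
    using to_nat_on_finite[of "UNIV :: 'a set"] by (simp add: bij_betw_def)
  finally show ?thesis
    by (simp add: image_Suc_lessThan)
qed

lemma inj_pos: "inj (pos :: 'a::finite \<Rightarrow> nat)"
  using to_nat_on_finite[of "UNIV :: 'a set"] by (auto simp: bij_betw_def inj_on_def pos_def)

lemma pos_eq_iff [simp]: "pos i = pos i' \<longleftrightarrow> i = i'"
  using inj_pos by (auto simp: inj_def)

lemma pos_bounds: "1 \<le> pos (i :: 'a::finite)" "pos i \<le> CARD('a)"
  using pos_image[where ?'a = 'a] by auto

text \<open>At most one index sits at position \<open>n\<close>. The range condition guards
  \<open>the_inv\<close>, which has a meaning only for attained positions.\<close>

lemma sum_pos_eq:
  "(\<Sum>l\<in>(UNIV :: 'l::finite set). if n = pos l then f l else (0::real))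
    = (if 1 \<le> n \<and> n \<le> CARD('l) then f (the_inv pos n) else 0)"
proof (cases "1 \<le> n \<and> n \<le> CARD('l)")
  case True
  then obtain l0 :: 'l where n: "n = pos l0"
    using pos_image[where ?'a = 'l] by (metis atLeastAtMost_iff imageE)
  then show ?thesis
    using True by (simp add: the_inv_f_f inj_pos)
next
  case False
  then have "n \<noteq> pos l" for l :: 'l
    using pos_bounds[of l] by auto
  then show ?thesis using False by auto
qed

text \<open>Entry \<open>(i, j)\<close> of \<open>rect_diag f ** transpose V\<close>, that is, the
  coordinate of column \<open>j\<close> of the product along \<open>column i U\<close>. At most one
  summand is nonzero, and none if \<open>pos i > CARD('l)\<close>.\<close>

definition svd_coord :: "(nat \<Rightarrow> real) \<Rightarrow> real^'l^'l \<Rightarrow> 'm::finite \<Rightarrow> 'l \<Rightarrow> real" where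
  "svd_coord f V i j = (\<Sum>l\<in>UNIV. if pos i = pos l then f (pos i) * V $ j $ l else 0)"

lemma column_svd:
  fixes U :: "real^'m^'m" and V :: "real^'l^'l"
  shows "column j (U ** rect_diag f ** transpose V) = (\<Sum>i\<in>UNIV. svd_coord f V i j *\<^sub>R column i U)"
proof -
  have D: "rect_diag f ** transpose V = (\<chi> i j. svd_coord f V i j)"
    by (auto simp: matrix_matrix_mult_def rect_diag_def transpose_def vec_eq_iff svd_coord_def intro!: sum.cong)
  show ?thesis
    unfolding matrix_mul_assoc[symmetric] D
    by (simp add: vec_eq_iff column_def matrix_matrix_mult_def mult.commute)
qed

lemma svd_coord_truncate:
  "svd_coord (\<lambda>i. if i \<le> q then f i else 0) V i j = (if pos i \<le> q then svd_coord f V i j else 0)"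
  by (simp add: svd_coord_def cong: if_cong)

text \<open>The rows of \<open>rect_diag f ** transpose V\<close> are multiples of distinct, hence
  orthonormal, columns of \<open>V\<close>. Rows beyond position \<open>CARD('l)\<close> vanish,
  which explains the default 0.\<close>

lemma sum_svd_coord_mult:
  fixes V :: "real^'l^'l" and i i' :: "'m::finite"
  assumes V: "orthogonal_matrix V"
  shows "(\<Sum>j\<in>UNIV. svd_coord f V i j * svd_coord f V i' j)
    = (if i = i' then (if pos i \<le> CARD('l) then f (pos i) else 0)\<^sup>2 else 0)"
proof -
  have VV: "(\<Sum>j\<in>UNIV. V $ j $ l * V $ j $ l') = (if l = l' then 1 else 0)" for l l'
  proof -
    have "transpose V ** V = mat 1"
      using V by (simp add: orthogonal_matrix)
    then have "(transpose V ** V) $ l $ l' = (mat 1 :: real^'l^'l) $ l $ l'"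
      by simp
    then show ?thesis
      by (simp add: matrix_matrix_mult_def transpose_def mat_def)
  qed
  have coord: "svd_coord f V i j = (if pos i \<le> CARD('l) then f (pos i) * V $ j $ the_inv pos (pos i) else 0)" for i :: 'm and j
    unfolding svd_coord_def sum_pos_eq using pos_bounds(1)[of i] by simp
  show ?thesis
  proof (cases "pos i \<le> CARD('l) \<and> pos i' \<le> CARD('l)")
    case True
    then have "pos i \<in> range (pos :: 'l \<Rightarrow> nat)" "pos i' \<in> range (pos :: 'l \<Rightarrow> nat)"
      using pos_bounds(1)[of i] pos_bounds(1)[of i'] by (auto simp: pos_image)
    then obtain l l' :: 'l where l: "pos i = pos l" "pos i' = pos l'"
      by (auto simp: image_iff)
    have "(\<Sum>j\<in>UNIV. svd_coord f V i j * svd_coord f V i' j)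
        = f (pos i) * f (pos i') * (\<Sum>j\<in>UNIV. V $ j $ l * V $ j $ l')"
      unfolding coord using True
      by (simp add: l the_inv_f_f inj_pos sum_distrib_left mult_ac)
    also have "l = l' \<longleftrightarrow> i = i'"
      using l by (metis pos_eq_iff)
    ultimately show ?thesis
      using True by (auto simp: VV power2_eq_square)
  next
    case False
    then show ?thesis by (auto simp: coord)
  qed
qed

section \<open>Left singular vectors, column space and rank\<close>

lemma orthogonal_matrix_column_inner:
  fixes U :: "real^'m^'m"
  assumes "orthogonal_matrix U"
  shows "column i U \<bullet> column i' U = (if i = i' then 1 else 0)"
  using assms unfolding orthogonal_matrix_orthonormal_columns
  by (auto simp: norm_eq_1 orthogonal_def)

text \<open>The inner products are the entries of \<open>transpose U *v x\<close>, and
  \<open>transpose U\<close> preserves the norm.\<close>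

lemma orthogonal_matrix_parseval:
  fixes U :: "real^'m^'m"
  assumes U: "orthogonal_matrix U"
  shows "(\<Sum>i\<in>UNIV. (column i U \<bullet> x)\<^sup>2) = (norm x)\<^sup>2"
proof -
  have "(\<Sum>i\<in>UNIV. (column i U \<bullet> x)\<^sup>2) = (norm (transpose U *v x))\<^sup>2"
    by (simp add: norm_vec_def L2_set_def sum_nonneg matrix_vector_mult_def column_def transpose_def inner_vec_def)
  also have "\<dots> = x \<bullet> (U *v (transpose U *v x))"
    by (simp only: power2_norm_eq_inner transpose_matrix_vector dot_lmul_matrix)
  also have "\<dots> = (norm x)\<^sup>2"
    using U by (simp add: matrix_vector_mul_assoc orthogonal_matrix_def power2_norm_eq_inner del: transpose_matrix_vector)
  finally show ?thesis .
qed

text \<open>Apply \<open>M\<close> to the right singular vector belonging to \<open>column i U\<close>.\<close>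

lemma left_singular_vector_in_span:
  fixes M :: "real^'l^'m"
  assumes svd: "is_svd M U \<sigma> V" and i: "pos i \<le> CARD('l)" "\<sigma> (pos i) \<noteq> 0"
  shows "column i U \<in> span (columns M)"
proof -
  have "pos i \<in> range (pos :: 'l \<Rightarrow> nat)"
    using pos_bounds(1)[of i] i by (auto simp: pos_image)
  then obtain l :: 'l where l: "pos i = pos l"
    by (auto simp: image_iff)
  have V: "transpose V ** V = mat 1" and M: "M = U ** rect_diag \<sigma> ** transpose V"
    using svd by (auto simp: is_svd_def orthogonal_matrix)
  have "M ** V = U ** rect_diag \<sigma>"
    unfolding M by (simp add: matrix_mul_assoc[symmetric] V)
  then have "M *v column l V = column l (U ** rect_diag \<sigma>)"
    by (metis matrix_vector_mul_assoc matrix_vector_mult_basis)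
  also have "\<dots> = \<sigma> (pos i) *\<^sub>R column i U"
    using l by (simp add: vec_eq_iff column_def matrix_matrix_mult_def rect_diag_def l[symmetric]
        if_distrib[of "\<lambda>t. _ * t"] cong: if_cong)
  finally have "\<sigma> (pos i) *\<^sub>R column i U \<in> span (columns M)"
    by (metis matrix_vector_mult_in_columnspace)
  from span_scale[OF this, of "1 / \<sigma> (pos i)"] i show ?thesis
    by simp
qed

text \<open>The left singular vectors with nonzero singular value form an orthonormal basis of the
  column space.\<close>

lemma rank_eq_card_nonzero_singular_values:
  fixes M :: "real^'l^'m"
  assumes svd: "is_svd M U \<sigma> V"
  shows "rank M = card {i::'m. pos i \<le> CARD('l) \<and> \<sigma> (pos i) \<noteq> 0}"
proof -
  let ?N = "{i::'m. pos i \<le> CARD('l) \<and> \<sigma> (pos i) \<noteq> 0}"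
  let ?u = "\<lambda>i. column i U"
  have U: "orthogonal_matrix U" and M: "M = U ** rect_diag \<sigma> ** transpose V"
    using svd by (auto simp: is_svd_def)
  have inj: "inj ?u"
    using orthogonal_matrix_column_inner[OF U] by (intro injI) (metis zero_neq_one)
  have "independent (?u ` ?N)"
  proof (rule pairwise_orthogonal_independent)
    show "pairwise orthogonal (?u ` ?N)"
      using orthogonal_matrix_column_inner[OF U] by (auto simp: pairwise_def orthogonal_def)
    have "?u i \<noteq> 0" for i
      using orthogonal_matrix_column_inner[OF U, of i i] by auto
    then show "0 \<notin> ?u ` ?N" by auto
  qed
  then have "dim (?u ` ?N) = card (?u ` ?N)"
    by (rule dim_eq_card_independent)
  moreover have "span (columns M) = span (?u ` ?N)"
  proof (rule subset_antisym; rule span_minimal)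
    show "columns M \<subseteq> span (?u ` ?N)"
    proof
      fix x assume "x \<in> columns M"
      then obtain j where "x = column j M" by (auto simp: columns_def)
      then have x: "x = (\<Sum>i\<in>UNIV. svd_coord \<sigma> V i j *\<^sub>R ?u i)"
        by (simp only: M column_svd)
      have "svd_coord \<sigma> V i j *\<^sub>R ?u i \<in> span (?u ` ?N)" for i
      proof (cases "i \<in> ?N")
        case False
        then have "svd_coord \<sigma> V i j = 0"
          using pos_bounds(2)[where ?'a = 'l] by (auto simp: svd_coord_def intro!: sum.neutral)
        then show ?thesis by (simp add: span_zero)
      qed (intro span_scale span_base imageI)
      then show "x \<in> span (?u ` ?N)"
        unfolding x by (intro span_sum)
    qed
    show "?u ` ?N \<subseteq> span (columns M)"
      using left_singular_vector_in_span[OF svd] by auto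
  qed auto
  ultimately have "dim (columns M) = card (?u ` ?N)"
    using dim_span[of "columns M"] dim_span[of "?u ` ?N"] by simp
  also have "\<dots> = card ?N"
    using inj by (intro card_image) (auto simp: inj_on_def)
  finally show ?thesis
    by (simp add: column_rank_def)
qed

text \<open>By monotonicity a nonzero value at position \<open>pos i\<close> makes all earlier ones
  nonzero as well, and there are only \<open>rank M\<close> nonzero values.\<close>

lemma singular_value_nonzero_iff:
  fixes M :: "real^'l^'m"
  assumes svd: "is_svd M U \<sigma> V" and positive: "\<forall>i\<in>{1..rank M}. 0 < \<sigma> i"
  shows "pos (i::'m) \<le> CARD('l) \<and> \<sigma> (pos i) \<noteq> 0 \<longleftrightarrow> pos i \<le> rank M"
proof
  assume "pos i \<le> rank M"
  then have "0 < \<sigma> (pos i)"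
    using positive pos_bounds(1)[of i] by simp
  with \<open>pos i \<le> rank M\<close> show "pos i \<le> CARD('l) \<and> \<sigma> (pos i) \<noteq> 0"
    using rank_bound[of M] by simp
next
  let ?N = "{i::'m. pos i \<le> CARD('l) \<and> \<sigma> (pos i) \<noteq> 0}"
  assume i: "pos i \<le> CARD('l) \<and> \<sigma> (pos i) \<noteq> 0"
  have nonneg: "0 \<le> \<sigma> k" if "1 \<le> k" "k \<le> CARD('m)" "k \<le> CARD('l)" for k
    using svd that by (auto simp: is_svd_def)
  have mono: "\<sigma> k \<le> \<sigma> k'" if "1 \<le> k'" "k' \<le> k" "k \<le> CARD('m)" "k \<le> CARD('l)" for k k'
    using svd that by (auto simp: is_svd_def)
  have "{1..pos i} \<subseteq> pos ` ?N"
  proof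
    fix k assume k: "k \<in> {1..pos i}"
    then have "k \<in> pos ` (UNIV :: 'm set)"
      using pos_bounds(2)[of i] by (simp add: pos_image)
    then obtain i' :: 'm where "k = pos i'" by auto
    moreover have "\<sigma> k > 0"
      using k i nonneg[of "pos i"] mono[of k "pos i"] pos_bounds[of i] by fastforce
    ultimately show "k \<in> pos ` ?N" using k i by auto
  qed
  then have "card {1..pos i} \<le> card (pos ` ?N)"
    by (intro card_mono) auto
  also have "\<dots> = card ?N"
    using inj_pos by (intro card_image) (auto simp: inj_on_def)
  also have "\<dots> = rank M"
    by (rule rank_eq_card_nonzero_singular_values[OF svd, symmetric])
  finally show "pos i \<le> rank M" by simp
qed

subsection \<open>Identification of the minimiser\<close>

lemma column_map_columns: "column j (map_columns f M) = f (column j M)"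
  by (simp add: map_columns_def column_def vec_eq_iff)

lemma column_P_col: "column j (P_col A M) = orth_proj (span (columns A)) (column j M)"
  by (simp add: P_col_def column_map_columns)

lemma column_P_perp:
  "column j (P_perp A M) = column j M - orth_proj (span (columns A)) (column j M)"
  by (simp add: P_perp_def column_map_columns orth_proj_orthogonal_comp)

lemma column_add: "column j (M + N) = column j M + column j N"
  by (simp add: vec_eq_iff column_def)

lemma norm_sq_sum_orthonormal:
  fixes u :: "'i::finite \<Rightarrow> 'a::real_inner"
  assumes "\<And>i i'. u i \<bullet> u i' = (if i = i' then 1 else 0)"
  shows "(norm (\<Sum>i\<in>UNIV. x i *\<^sub>R u i))\<^sup>2 = (\<Sum>i\<in>UNIV. (x i)\<^sup>2)"
  unfolding power2_norm_eq_inner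
  by (simp add: inner_sum_left inner_sum_right assms power2_eq_square
      if_distrib[of "\<lambda>t. _ * t"] cong: if_cong)

lemma dim_Un_finite_le:
  fixes S T :: "'a::euclidean_space set"
  assumes "finite T"
  shows "dim (S \<union> T) \<le> dim S + card T"
proof -
  obtain B where B: "B \<subseteq> S" "independent B" "S \<subseteq> span B" "card B = dim S"
    using basis_exists by blast
  then have fin: "finite B" by (simp add: independent_imp_finite)
  have "S \<union> T \<subseteq> span (B \<union> T)"
    using B(3) span_mono[of B "B \<union> T"] span_superset[of "B \<union> T"] by blast
  then have "dim (S \<union> T) \<le> card (B \<union> T)"
    using fin assms by (intro dim_le_card) auto
  also have "\<dots> \<le> dim S + card T"
    using card_Un_le[of B T] B(4) by simp
  finally show ?thesis .
qed

text \<open>Each \<open>i\<close> in \<open>E\<close> brings \<open>{1..i}\<close> along, so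
  \<open>i \<le> card E\<close>; equal cardinality does the rest. Thus counting the singular values
  above the threshold locates the cut.\<close>

lemma down_closed_eq_atLeastAtMost:
  fixes E :: "nat set"
  assumes "finite E" "0 \<notin> E" and down: "\<And>i k. i \<in> E \<Longrightarrow> 1 \<le> k \<Longrightarrow> k \<le> i \<Longrightarrow> k \<in> E"
  shows "E = {1..card E}"
proof (rule card_subset_eq)
  show "E \<subseteq> {1..card E}"
  proof
    fix i assume i: "i \<in> E"
    then have "{1..i} \<subseteq> E" using down by auto
    then have "card {1..i} \<le> card E" using assms(1) by (rule card_mono[rotated])
    moreover have "i \<noteq> 0" using i assms(2) by metis
    ultimately show "i \<in> {1..card E}" by simp
  qed
qed auto

theorem theorem2p4:
  fixes A1 :: "real^'k^'m" and A2 :: "real^'l^'m" and \<tau> :: real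
    and s :: nat
    and U :: "real^'m^'m" and \<sigma> :: "nat \<Rightarrow> real" and V :: "real^'l^'l"
    and Xhat :: "real^('k + 'l)^'m \<Rightarrow> real^('k + 'l)^'m"
  assumes tau_pos: "\<tau> > 0"
    and s_def: "s = rank (P_perp A1 A2)"
    and svd: "is_svd (P_perp A1 A2) U \<sigma> V"
    and decreasing: "\<forall>i. 1 \<le> i \<and> i < s \<longrightarrow> \<sigma> (i + 1) < \<sigma> i"
    and positive: "\<forall>i\<in>{1..s}. 0 < \<sigma> i"
    and tau_generic: "\<forall>i\<in>{1..s}. \<tau> \<noteq> (\<sigma> i)\<^sup>2"
    and solution: "\<forall>W. (\<forall>i j. W $ i $ j > 0) \<longrightarrow> is_solution (block A1 A2) \<tau> W (Xhat W)"
  shows "\<exists>r\<in>{0..s}.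
           (sv_ext s \<sigma> (r + 1))\<^sup>2 \<le> ereal \<tau> \<and> ereal \<tau> < (sv_ext s \<sigma> r)\<^sup>2 \<and>
           {L. accumulation_point Xhat L} =
             {block A1 (P_col A1 A2 + hard_threshold r U \<sigma> V)}"
proof -
  let ?K = "span (columns A1)"
  \<comment> \<open>The data for \<open>penalised_minimiser_unique\<close>: left singular vectors,
    coordinates of the columns of \<open>P_perp A1 A2\<close> in them, and singular values padded
    with 0 when there are more rows than columns.\<close>
  define u where "u i = column i U" for i
  define c :: "'m \<Rightarrow> 'l \<Rightarrow> real" where "c = svd_coord \<sigma> V"
  define d where "d i = (if pos i \<le> CARD('l) then \<sigma> (pos i) else 0)" for i :: 'm
  define E where "E = {i \<in> {1..s}. \<tau> < (\<sigma> i)\<^sup>2}"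
  define r where "r = card E"
  define T where "T = P_col A1 A2 + hard_threshold r U \<sigma> V"
  have U: "orthogonal_matrix U" and V: "orthogonal_matrix V"
    and M: "P_perp A1 A2 = U ** rect_diag \<sigma> ** transpose V"
    using svd by (auto simp: is_svd_def)
  have s_le: "s \<le> CARD('m)" "s \<le> CARD('l)"
    using rank_bound[of "P_perp A1 A2"] by (auto simp: s_def)

  have E_eq: "E = {1..r}"
    unfolding r_def
  proof (rule down_closed_eq_atLeastAtMost)
    fix i k assume i: "i \<in> E" and k: "1 \<le> k" "k \<le> i"
    have "\<sigma> i \<le> \<sigma> k"
      using svd i k s_le unfolding is_svd_def E_def by auto
    moreover have "0 < \<sigma> i" using i positive by (auto simp: E_def)
    ultimately have "(\<sigma> i)\<^sup>2 \<le> (\<sigma> k)\<^sup>2" by (simp add: power_mono)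
    then show "k \<in> E" using i k by (auto simp: E_def)
  qed (auto simp: E_def)
  have E: "i \<in> E \<longleftrightarrow> 1 \<le> i \<and> i \<le> r" for i
    unfolding E_eq by simp
  have "E \<subseteq> {1..s}"
    by (auto simp: E_def)
  then have "r \<le> s"
    using card_mono[of "{1..s}" E] by (simp add: r_def)

  have d_nonzero: "d i \<noteq> 0 \<longleftrightarrow> pos i \<le> s" for i
    using singular_value_nonzero_iff[OF svd, of i] positive by (auto simp: d_def s_def)
  \<comment> \<open>Positions beyond \<open>s\<close> have \<open>d i = 0\<close>, which is below
    the threshold since \<open>\<tau> > 0\<close>, and they are also beyond \<open>r\<close> since
    \<open>r \<le> s\<close>.\<close>
  have d_cases: "(d i)\<^sup>2 \<noteq> \<tau>" "(d i)\<^sup>2 < \<tau> \<longleftrightarrow> \<not> pos i \<le> r" for i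
  proof -
    have "(d i)\<^sup>2 \<noteq> \<tau> \<and> ((d i)\<^sup>2 < \<tau> \<longleftrightarrow> \<not> pos i \<le> r)"
    proof (cases "pos i \<le> s")
      case True
      then have "d i = \<sigma> (pos i)" "pos i \<in> {1..s}"
        using s_le pos_bounds(1)[of i] by (auto simp: d_def)
      moreover from this have "\<tau> \<noteq> (\<sigma> (pos i))\<^sup>2"
        using tau_generic by blast
      ultimately show ?thesis
        using E[of "pos i"] by (auto simp: E_def)
    next
      case False
      then have "d i = 0" using d_nonzero[of i] by blast
      then show ?thesis using False \<open>r \<le> s\<close> tau_pos by simp
    qed
    then show "(d i)\<^sup>2 \<noteq> \<tau>" "(d i)\<^sup>2 < \<tau> \<longleftrightarrow> \<not> pos i \<le> r" by auto
  qed

  have parseval: "(\<Sum>i\<in>UNIV. (u i \<bullet> x)\<^sup>2) = (norm x)\<^sup>2" for x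
    unfolding u_def by (rule orthogonal_matrix_parseval[OF U])
  have uu: "u i \<bullet> u i' = (if i = i' then 1 else 0)" for i i'
    unfolding u_def by (rule orthogonal_matrix_column_inner[OF U])
  have gram: "(\<Sum>j\<in>UNIV. c i j * c i' j) = (if i = i' then (d i)\<^sup>2 else 0)" for i i'
    unfolding c_def d_def by (rule sum_svd_coord_mult[OF V])
  have perp: "column j (P_perp A1 A2) = (\<Sum>i\<in>UNIV. c i j *\<^sub>R u i)" for j
    unfolding M c_def u_def by (rule column_svd)
  \<comment> \<open>Such \<open>u i\<close> lies in the column space of \<open>P_perp A1 A2\<close>,
    whose generators are residuals of projections to \<open>?K\<close>.\<close>
  have uK: "orthogonal (u i) z" if "d i \<noteq> 0" "z \<in> ?K" for i z
  proof -
    have "orthogonal z y" if "y \<in> columns (P_perp A1 A2)" for y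
      using that \<open>z \<in> ?K\<close> orthogonal_orth_proj[OF subspace_span]
      by (auto simp: columns_def column_P_perp orthogonal_commute)
    moreover have "u i \<in> span (columns (P_perp A1 A2))"
      unfolding u_def using that(1) by (intro left_singular_vector_in_span[OF svd]) (auto simp: d_def split: if_splits)
    ultimately show ?thesis
      using orthogonal_to_span orthogonal_commute by blast
  qed
  have aK: "column j A2 - (\<Sum>i\<in>UNIV. c i j *\<^sub>R u i) \<in> ?K" for j
    using orth_proj_in[OF subspace_span] by (simp add: perp[symmetric] column_P_perp)
  have T: "column j T = orth_proj ?K (column j A2) + (\<Sum>i\<in>UNIV. if pos i \<le> r then c i j *\<^sub>R u i else 0)" for j
    unfolding T_def hard_threshold_def column_add column_P_col column_svd svd_coord_truncate
    by (auto simp: c_def u_def intro!: sum.cong)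
  \<comment> \<open>The part in \<open>?K\<close> cancels; what remains are the singular components
    discarded by the threshold.\<close>
  have A2_T: "column j A2 - column j T = (\<Sum>i\<in>UNIV. (if pos i \<le> r then 0 else c i j) *\<^sub>R u i)" for j
  proof -
    have "column j A2 - column j T = (\<Sum>i\<in>UNIV. c i j *\<^sub>R u i) - (\<Sum>i\<in>UNIV. if pos i \<le> r then c i j *\<^sub>R u i else 0)"
      unfolding T perp[symmetric] column_P_perp by simp
    also have "\<dots> = (\<Sum>i\<in>UNIV. (if pos i \<le> r then 0 else c i j) *\<^sub>R u i)"
      unfolding sum_subtractf[symmetric] by (auto intro!: sum.cong)
    finally show ?thesis .
  qed
  have rank_T: "rank (block A1 T) \<le> dim ?K + card {i::'m. pos i \<le> r}"
  proof -
    let ?N = "u ` {i. pos i \<le> r}"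
    have "columns T \<subseteq> span (?K \<union> ?N)"
    proof
      fix x assume "x \<in> columns T"
      then obtain j where x: "x = column j T" by (auto simp: columns_def)
      show "x \<in> span (?K \<union> ?N)"
        unfolding x T using orth_proj_in[OF subspace_span]
        by (intro span_add span_sum) (auto intro: span_base span_scale span_zero)
    qed
    moreover have "columns A1 \<subseteq> span (?K \<union> ?N)"
      using span_superset[of "?K \<union> ?N"] span_superset[of "columns A1"] by blast
    ultimately have "rank (block A1 T) \<le> dim (span (?K \<union> ?N))"
      unfolding column_rank_def columns_block by (intro dim_subset) auto
    also have "\<dots> \<le> dim ?K + card ?N"
      unfolding dim_span[of "?K \<union> ?N"] by (rule dim_Un_finite_le) simp
    also have "card ?N \<le> card {i::'m. pos i \<le> r}"
      by (rule card_image_le) simp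
    finally show ?thesis by simp
  qed
  have "(norm (A2 - T))\<^sup>2 = (\<Sum>j\<in>UNIV. \<Sum>i\<in>UNIV. if pos i \<le> r then 0 else c i j * c i j)"
    unfolding norm_sq_eq_sum_columns column_diff A2_T norm_sq_sum_orthonormal[OF uu]
    by (auto simp: power2_eq_square intro!: sum.cong)
  also have "\<dots> = (\<Sum>i\<in>UNIV. if pos i \<le> r then 0 else (d i)\<^sup>2)"
    by (subst sum.swap) (auto simp: gram intro!: sum.cong)
  finally have norm_T: "(norm (A2 - T))\<^sup>2 = (\<Sum>i\<in>UNIV. if pos i \<le> r then 0 else (d i)\<^sup>2)" .
  \<comment> \<open>\<open>T\<close> meets the lower bound: a discarded component costs
    \<open>(d i)\<^sup>2\<close>, a kept one raises the rank bound by 1 and costs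
    \<open>\<tau>\<close>, and \<open>d_cases\<close> says that each choice is the cheaper
    one.\<close>
  have opt_T: "(norm (A2 - T))\<^sup>2 + \<tau> * rank (block A1 T)
      \<le> (\<Sum>i\<in>UNIV. min ((d i)\<^sup>2) \<tau>) + \<tau> * dim ?K"
  proof -
    have "(\<Sum>i\<in>UNIV. min ((d i)\<^sup>2) \<tau>)
        = (\<Sum>i\<in>UNIV. (if pos i \<le> r then 0 else (d i)\<^sup>2) + (if pos i \<le> r then \<tau> else 0))"
    proof (rule sum.cong)
      show "min ((d i)\<^sup>2) \<tau> = (if pos i \<le> r then 0 else (d i)\<^sup>2) + (if pos i \<le> r then \<tau> else 0)" for i
        using d_cases[of i] by auto
    qed simp
    also have "\<dots> = (norm (A2 - T))\<^sup>2 + \<tau> * card {i::'m. pos i \<le> r}"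
      by (simp add: sum.distrib norm_T sum.If_cases mult.commute)
    finally show ?thesis
      using mult_left_mono[of "real (rank (block A1 T))" "real (dim ?K + card {i::'m. pos i \<le> r})" \<tau>]
        rank_T tau_pos by (simp add: distrib_left)
  qed

  have unique: "L = block A1 T" if acc: "accumulation_point Xhat L" for L
  proof -
    obtain L2 where L: "L = block A1 L2"
      and opt: "\<And>Y. (norm (A2 - L2))\<^sup>2 + \<tau> * rank (block A1 L2) \<le> (norm (A2 - Y))\<^sup>2 + \<tau> * rank (block A1 Y)"
      using accumulation_point_minimises[OF tau_pos _ acc] solution by blast
    let ?S = "span (columns (block A1 L2))"
    have "column j L2 = column j A2 - (\<Sum>i\<in>UNIV. if (d i)\<^sup>2 < \<tau> then c i j *\<^sub>R u i else 0)" for j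
    proof (rule penalised_minimiser_unique[where K = ?K and S = ?S])
      show "?K \<subseteq> ?S" unfolding columns_block by (intro span_mono) auto
      show "column j L2 \<in> ?S" for j
        unfolding columns_block by (intro span_base) (auto simp: columns_def)
      show "norm (u i) = 1" for i using uu by (simp add: norm_eq_1)
      \<comment> \<open>\<open>L2\<close> is no worse than the competitor \<open>T\<close>; the rank
        is the dimension of the column space \<open>?S\<close>.\<close>
      show "(\<Sum>j\<in>UNIV. (norm (column j A2 - column j L2))\<^sup>2) + \<tau> * dim ?S
          \<le> (\<Sum>i\<in>UNIV. min ((d i)\<^sup>2) \<tau>) + \<tau> * dim ?K"
        using order_trans[OF opt opt_T] unfolding norm_sq_eq_sum_columns column_diff column_rank_def
        by simp
    qed (use parseval gram uK aK tau_pos d_cases(1) in auto)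
    also have "column j A2 - (\<Sum>i\<in>UNIV. if (d i)\<^sup>2 < \<tau> then c i j *\<^sub>R u i else 0) = column j T" for j
    proof -
      have "(\<Sum>i\<in>UNIV. if (d i)\<^sup>2 < \<tau> then c i j *\<^sub>R u i else 0) = column j A2 - column j T"
        unfolding A2_T by (auto simp: d_cases(2) intro!: sum.cong)
      then show ?thesis by simp
    qed
    finally have "L2 = T"
      by (simp add: vec_eq_iff column_def)
    then show ?thesis using L by simp
  qed
  \<comment> \<open>Uniqueness alone would allow the set to be empty.\<close>
  moreover have "\<exists>L. accumulation_point Xhat L"
    using accumulation_point_exists[OF tau_pos] solution by blast
  ultimately have acc: "{L. accumulation_point Xhat L} = {block A1 T}"
    by auto

  \<comment> \<open>Since \<open>E = {1..r}\<close>, index \<open>r + 1\<close> is outside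
    \<open>E\<close> or past \<open>s\<close>, where the convention gives 0. Likewise
    \<open>r\<close> is in \<open>E\<close> or is 0, where the convention gives
    \<open>\<infinity>\<close>.\<close>
  have "(sv_ext s \<sigma> (r + 1))\<^sup>2 \<le> ereal \<tau>"
  proof (cases "r + 1 \<le> s")
    case True
    then have "(\<sigma> (r + 1))\<^sup>2 \<le> \<tau>"
      using E[of "r + 1"] by (auto simp: E_def)
    then show ?thesis using True by (simp add: sv_ext_def)
  next
    case False
    then show ?thesis using tau_pos by (simp add: sv_ext_def power2_eq_square)
  qed
  moreover have "ereal \<tau> < (sv_ext s \<sigma> r)\<^sup>2"
  proof (cases "r = 0")
    case True
    then show ?thesis by (simp add: sv_ext_def power2_eq_square)
  next
    case False
    then show ?thesis using E[of r] by (auto simp: E_def sv_ext_def)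
  qed
  ultimately show ?thesis
    using \<open>r \<le> s\<close> acc unfolding T_def by auto
qed

end
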